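(* If $\Omega$ is a finitely branching tree quiver and $V$ is a locally finite-dimensional indecomposable representation of $\Omega$, then $V$ is FLEI, i.e. $V(a)$ is an isomorphism for all but finitely many arrows $a$ of $\Omega$.
   Context: Fix a field $\mathbb{F}$. A quiver $\Omega=(\Omega_0,\Omega_1)$ is a (possibly infinite) set $\Omega_0$ of vertices and a set $\Omega_1$ of ordered pairs of vertices called arrows. A representation $V$ assigns an $\mathbb{F}$-vector space $V(x)$ to each vertex and a linear map $V(a):V(x)\to V(y)$ to each arrow $a:x\to y$; it is locally finite-dimensional if every $V(x)$ is finite-dimensional. A subrepresentation is a choice of subspaces $W(x)\subseteq V(x)$ with $V(a)(W(x))\subseteq W(y)$ for all $a:x\to y$; direct sums are vertexwise; $V$ is indecomposable if it is nonzero and not the direct sum of two nonzero subrepresentations. A journey in $\Omega$ is a quiver morphism, injective on vertices, into $\Omega$ from a quiver whose underlying graph is a finite path $A_n$ or a one-way infinite path $A_\infty$ (with arbitrary orientation of the arrows). $\Omega$ is a tree if its underlying undirected (multi)graph contains no cycles (in particular no loops and no two arrows between the same pair of vertices). $\Omega$ is finitely branching if it is the union of (the images of) finitely many journeys. A representation is FLEI if all but finitely many arrows are sent to isomorphisms. *)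

theory Defs
  imports Complex_Main "Graph_Theory.Pair_Digraph"
begin

text \<open>
  Quivers are digraphs whose arrows are ordered pairs of vertices (locale
  \<^locale>\<open>pair_wf_digraph\<close>); both the vertex set and the arrow set may be infinite.
\<close>

section \<open>Tree quivers\<close>

text \<open>
  A cycle of the underlying undirected multigraph, with vertices \<open>vs\<close> and edges \<open>es\<close>: each arrow
  \<open>(x, y)\<close> is one edge with end points \<open>x\<close> and \<open>y\<close>, and the edge \<open>es ! i\<close> joins \<open>vs ! i\<close> to its
  cyclic successor in \<open>vs\<close>. Length 1 is a loop, length 2 a pair of opposite arrows.
\<close>

definition underlying_cycle :: "'v pair_pre_digraph \<Rightarrow> 'v list \<Rightarrow> ('v \<times> 'v) list \<Rightarrow> bool" where
  "underlying_cycle Q vs es \<longleftrightarrow>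
     es \<noteq> [] \<and> length vs = length es \<and> distinct vs \<and> distinct es \<and>
     set vs \<subseteq> pverts Q \<and> set es \<subseteq> parcs Q \<and>
     (\<forall>i < length es. {fst (es ! i), snd (es ! i)} = {vs ! i, vs ! (Suc i mod length es)})"

text \<open>Connectedness is not part of the definition.\<close>

definition tree_quiver :: "'v pair_pre_digraph \<Rightarrow> bool" where
  "tree_quiver Q \<longleftrightarrow> pair_wf_digraph Q \<and> \<not> (\<exists>vs es. underlying_cycle Q vs es)"

section \<open>Journeys and finitely branching quivers\<close>

text \<open>
  Quivers with underlying graph \<open>A\<^sub>n\<close> (\<open>n \<ge> 1\<close>) or \<open>A\<^sub>\<infinity>\<close>, on the vertices \<open>0, 1, 2, \<dots>\<close>:
  exactly one arrow, of either direction, joins consecutive vertices, and there are no others.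
\<close>

definition path_quiver :: "nat pair_pre_digraph \<Rightarrow> bool" where
  "path_quiver P \<longleftrightarrow>
     pair_wf_digraph P \<and>
     ((\<exists>n \<ge> 1. pverts P = {..<n}) \<or> pverts P = UNIV) \<and>
     (\<forall>(i, j) \<in> parcs P. j = Suc i \<or> i = Suc j) \<and>
     (\<forall>i. Suc i \<in> pverts P \<longrightarrow> ((i, Suc i) \<in> parcs P) \<noteq> ((Suc i, i) \<in> parcs P))"

definition quiver_morphism :: "'u pair_pre_digraph \<Rightarrow> 'v pair_pre_digraph \<Rightarrow> ('u \<Rightarrow> 'v) \<Rightarrow> bool" where
  "quiver_morphism P Q f \<longleftrightarrow>
     (\<forall>x \<in> pverts P. f x \<in> pverts Q) \<and> (\<forall>(x, y) \<in> parcs P. (f x, f y) \<in> parcs Q)"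

definition journey :: "'v pair_pre_digraph \<Rightarrow> nat pair_pre_digraph \<Rightarrow> (nat \<Rightarrow> 'v) \<Rightarrow> bool" where
  "journey Q P f \<longleftrightarrow> path_quiver P \<and> quiver_morphism P Q f \<and> inj_on f (pverts P)"

definition finitely_branching :: "'v pair_pre_digraph \<Rightarrow> bool" where
  "finitely_branching Q \<longleftrightarrow>
     (\<exists>J. finite J \<and> (\<forall>(P, f) \<in> J. journey Q P f) \<and>
        pverts Q = (\<Union>(P, f) \<in> J. f ` pverts P) \<and>
        parcs Q = (\<Union>(P, f) \<in> J. map_prod f f ` parcs P))"

section \<open>Representations\<close>

text \<open>
  The spaces \<open>V(x)\<close> are subspaces of one ambient vector space, whose type and scalar multiplication
  are arbitrary (any family of vector spaces embeds into its direct sum). The values of the linear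
  maps outside their domains, and of both fields outside the quiver, are irrelevant.
\<close>

record ('v, 'w) quiver_rep =
  rspace :: "'v \<Rightarrow> 'w set"
  rmap :: "'v \<times> 'v \<Rightarrow> 'w \<Rightarrow> 'w"

definition linear_between ::
  "('k::field \<Rightarrow> 'w \<Rightarrow> 'w::ab_group_add) \<Rightarrow> 'w set \<Rightarrow> 'w set \<Rightarrow> ('w \<Rightarrow> 'w) \<Rightarrow> bool" where
  "linear_between scale A B f \<longleftrightarrow>
     f ` A \<subseteq> B \<and>
     (\<forall>u \<in> A. \<forall>w \<in> A. f (u + w) = f u + f w) \<and>
     (\<forall>c. \<forall>u \<in> A. f (scale c u) = scale c (f u))"

definition quiver_representation ::
  "('k::field \<Rightarrow> 'w \<Rightarrow> 'w::ab_group_add) \<Rightarrow> 'v pair_pre_digraph \<Rightarrow> ('v, 'w) quiver_rep \<Rightarrow> bool" where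
  "quiver_representation scale Q V \<longleftrightarrow>
     (\<forall>x \<in> pverts Q. module.subspace scale (rspace V x)) \<and>
     (\<forall>(x, y) \<in> parcs Q. linear_between scale (rspace V x) (rspace V y) (rmap V (x, y)))"

definition locally_finite_dimensional ::
  "('k::field \<Rightarrow> 'w \<Rightarrow> 'w::ab_group_add) \<Rightarrow> 'v pair_pre_digraph \<Rightarrow> ('v, 'w) quiver_rep \<Rightarrow> bool" where
  "locally_finite_dimensional scale Q V \<longleftrightarrow>
     (\<forall>x \<in> pverts Q. \<exists>B. finite B \<and> module.span scale B = rspace V x)"

definition subrepresentation ::
  "('k::field \<Rightarrow> 'w \<Rightarrow> 'w::ab_group_add) \<Rightarrow> 'v pair_pre_digraph \<Rightarrow> ('v, 'w) quiver_rep \<Rightarrow>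
   ('v \<Rightarrow> 'w set) \<Rightarrow> bool" where
  "subrepresentation scale Q V W \<longleftrightarrow>
     (\<forall>x \<in> pverts Q. module.subspace scale (W x) \<and> W x \<subseteq> rspace V x) \<and>
     (\<forall>(x, y) \<in> parcs Q. rmap V (x, y) ` W x \<subseteq> W y)"

definition nonzero_family :: "'v pair_pre_digraph \<Rightarrow> ('v \<Rightarrow> 'w::zero set) \<Rightarrow> bool" where
  "nonzero_family Q W \<longleftrightarrow> (\<exists>x \<in> pverts Q. W x \<noteq> {0})"

definition direct_sum_of ::
  "'v pair_pre_digraph \<Rightarrow> ('v, 'w::ab_group_add) quiver_rep \<Rightarrow> ('v \<Rightarrow> 'w set) \<Rightarrow> ('v \<Rightarrow> 'w set) \<Rightarrow> bool" where
  "direct_sum_of Q V W1 W2 \<longleftrightarrow>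
     (\<forall>x \<in> pverts Q. rspace V x = {u + w | u w. u \<in> W1 x \<and> w \<in> W2 x} \<and> W1 x \<inter> W2 x = {0})"

definition indecomposable ::
  "('k::field \<Rightarrow> 'w \<Rightarrow> 'w::ab_group_add) \<Rightarrow> 'v pair_pre_digraph \<Rightarrow> ('v, 'w) quiver_rep \<Rightarrow> bool" where
  "indecomposable scale Q V \<longleftrightarrow>
     nonzero_family Q (rspace V) \<and>
     \<not> (\<exists>W1 W2. subrepresentation scale Q V W1 \<and> subrepresentation scale Q V W2 \<and>
          nonzero_family Q W1 \<and> nonzero_family Q W2 \<and> direct_sum_of Q V W1 W2)"

text \<open>
  In a representation, \<open>V(a)\<close> is linear on \<open>V(x)\<close>, so it is an isomorphism onto \<open>V(y)\<close> iff it is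
  bijective.
\<close>

definition flei :: "'v pair_pre_digraph \<Rightarrow> ('v, 'w) quiver_rep \<Rightarrow> bool" where
  "flei Q V \<longleftrightarrow>
     finite {(x, y) \<in> parcs Q. \<not> bij_betw (rmap V (x, y)) (rspace V x) (rspace V y)}"

end

theory Submission
  imports Defs
begin

text \<open>
  If infinitely many arrows fail to be isomorphisms, then so do infinitely many arrows along one
  infinite journey. As there are no cycles, every journey leaves or enters that ray at most once
  in each direction, so the ray is eventually pendant: from some vertex on, its vertices have no
  neighbours outside it.

  On a ray starting at \<open>y\<^sub>0\<close>, every locally finite-dimensional representation splits as \<open>P \<oplus> R\<close> with
  \<open>R(y\<^sub>0) = 0\<close>, where in \<open>P\<close> the arrows away from \<open>y\<^sub>0\<close> are surjective and those towards \<open>y\<^sub>0\<close> are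
  injective (\<open>P\<close> collects the intervals that start at \<open>y\<^sub>0\<close>). For a tail of the pendant ray, \<open>R\<close> is a
  direct summand of the whole representation, because it vanishes where the tail is attached. If
  the tail starts late enough, the complement is nonzero and indecomposability forces \<open>R = 0\<close>.
  Then dimensions never increase along the tail, hence are eventually constant, and all later arrows are
  isomorphisms.
\<close>

section \<open>Subspaces of a finite-dimensional space\<close>

context vector_space
begin

text \<open>The ambient space may be infinite-dimensional, so finite-dimensionality of
  \<open>A\<close> is expressed by a finite \<open>B\<close> whose span contains \<open>A\<close>;
  this keeps \<open>dim\<close> away from the default value 0 of \<open>card\<close> on infinite
  bases.\<close>

lemma finite_dim_basis:
  assumes "finite B" "A \<subseteq> span B"
  obtains b where "b \<subseteq> A" "independent b" "A \<subseteq> span b" "finite b" "card b = dim A"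
  using basis_exists[of A] independent_span_bound[OF assms(1)] assms(2) by (metis order_trans)

lemma dim_le_of_subset:
  assumes "finite B" "C \<subseteq> span B" "A \<subseteq> C"
  shows "dim A \<le> dim C"
proof -
  obtain c where c: "C \<subseteq> span c" "finite c" "card c = dim C"
    using finite_dim_basis[OF assms(1,2)] by metis
  then show ?thesis
    using dim_le_card[of A c] assms(3) by auto
qed

lemma dim_less_of_psubset:
  assumes "finite B" "C \<subseteq> span B" "subspace A" "A \<subset> C"
  shows "dim A < dim C"
proof -
  obtain a where a: "a \<subseteq> A" "independent a" "A \<subseteq> span a" "finite a" "card a = dim A"
    using finite_dim_basis[of B A] assms by blast
  obtain x where x: "x \<in> C" "x \<notin> A" using assms(4) by blast
  have "span a = A" by (simp add: a assms(3) span_subspace)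
  then have ind: "independent (insert x a)" and "x \<notin> a"
    using x a(1,2) by (auto simp: independent_insert)
  obtain c where c: "C \<subseteq> span c" "finite c" "card c = dim C"
    using finite_dim_basis[OF assms(1,2)] by metis
  have "insert x a \<subseteq> span c" using a(1) x c(1) assms(4) by blast
  then have "card (insert x a) \<le> card c"
    using independent_span_bound[OF c(2) ind] by blast
  then show ?thesis using \<open>x \<notin> a\<close> a(4,5) c(3) by simp
qed

lemma subspace_eq_of_dim_le:
  assumes "finite B" "C \<subseteq> span B" "subspace A" "A \<subseteq> C" "dim C \<le> dim A"
  shows "A = C"
  using dim_less_of_psubset[OF assms(1-3)] assms(4,5) by fastforce

text \<open>Maps of a representation are linear only on their subspace, while the library treats
  maps that are linear on the whole type. A total linear \<open>g\<close> is prescribed by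
  \<open>f\<close> on a basis of \<open>A\<close>; the points of \<open>A\<close> where both agree
  form a subspace, hence all of \<open>A\<close>.\<close>

lemma linear_between_extend:
  assumes "linear_between scale A C f" "subspace A"
  obtains g where "Vector_Spaces.linear scale scale g" "\<And>x. x \<in> A \<Longrightarrow> g x = f x"
proof -
  interpret vector_space_pair scale scale ..
  obtain b where b: "b \<subseteq> A" "independent b" "A \<subseteq> span b"
    using maximal_independent_subset[of A] by metis
  obtain g where g: "Vector_Spaces.linear scale scale g" "\<forall>x\<in>b. g x = f x"
    using linear_independent_extend[OF b(2)] by metis
  interpret g: Vector_Spaces.linear scale scale g by fact
  have f: "f (u + w) = f u + f w" "f (c *s u) = c *s f u" if "u \<in> A" "w \<in> A" for u w c
    using assms(1) that by (auto simp: linear_between_def)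
  have "subspace {x \<in> A. g x = f x}"
    using assms(2) f(2)[of 0 0 0] f
    by (auto simp: subspace_def g.add g.scale g.zero)
  then have "span b \<subseteq> {x \<in> A. g x = f x}"
    using b(1) g(2) by (intro span_minimal) auto
  with that[OF g(1)] b(3) show thesis by blast
qed

text \<open>The image of a basis spans the image. If \<open>f\<close> is not injective, a nonzero
  vector of its kernel extends to a basis; the image of that vector is redundant, so the dimension
  drops strictly.\<close>

lemma dim_linear_image_le:
  assumes "linear_between scale A C f" "subspace A" "finite B" "A \<subseteq> span B"
  shows "dim (f ` A) \<le> dim A" "dim A \<le> dim (f ` A) \<Longrightarrow> inj_on f A"
proof -
  interpret vector_space_pair scale scale ..
  obtain g where g: "Vector_Spaces.linear scale scale g" and gf: "\<And>x. x \<in> A \<Longrightarrow> g x = f x"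
    using linear_between_extend[OF assms(1,2)] by metis
  interpret g: Vector_Spaces.linear scale scale g by fact
  have im: "f ` A = g ` A" using gf by auto
  obtain b where b: "b \<subseteq> A" "A \<subseteq> span b" "finite b" "card b = dim A"
    using finite_dim_basis[OF assms(3,4)] by metis
  have "g ` A \<subseteq> span (g ` b)" using b(2) by (metis g.span_image image_mono)
  then have "dim (g ` A) \<le> card (g ` b)" using b(3) by (intro dim_le_card) auto
  also have "\<dots> \<le> dim A" using b(3,4) card_image_le by metis
  finally show "dim (f ` A) \<le> dim A" by (simp add: im)
  assume le: "dim A \<le> dim (f ` A)"
  show "inj_on f A"
  proof (rule ccontr)
    assume "\<not> inj_on f A"
    then obtain u w where uw: "u \<in> A" "w \<in> A" "u \<noteq> w" "g u = g w"
      using gf by (auto simp: inj_on_def)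
    define x where "x = u - w"
    have x: "x \<in> A" "x \<noteq> 0" "g x = 0"
      using uw assms(2) by (auto simp: x_def subspace_diff g.diff)
    then have "independent {x}" by simp
    then obtain c where c: "{x} \<subseteq> c" "c \<subseteq> A" "independent c" "A \<subseteq> span c"
      using maximal_independent_subset_extend[of "{x}" A] x(1) by (metis empty_subsetI insert_subset)
    have fc: "finite c" using independent_span_bound[OF assms(3) c(3)] c(2) assms(4) by blast
    have cd: "card c = dim A" using basis_card_eq_dim[OF c(2,4,3)] .
    have "g ` c \<subseteq> insert 0 (g ` (c - {x}))" using x(3) by auto
    then have "span (g ` c) \<subseteq> span (g ` (c - {x}))"
      by (metis span_insert_0 span_mono)
    moreover have "g ` A \<subseteq> span (g ` c)" using c(4) by (metis g.span_image image_mono)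
    ultimately have "dim (g ` A) \<le> card (g ` (c - {x}))" using fc by (intro dim_le_card) auto
    also have "\<dots> \<le> card (c - {x})" using fc by (simp add: card_image_le)
    also have "\<dots> < card c" using c(1) fc by (intro card_Diff1_less) auto
    finally show False using le im cd by simp
  qed
qed

lemma dim_inj_image:
  assumes "linear_between scale A C f" "subspace A" "inj_on f A"
  shows "dim (f ` A) = dim A"
proof -
  interpret vector_space_pair scale scale ..
  obtain g where g: "Vector_Spaces.linear scale scale g" and gf: "\<And>x. x \<in> A \<Longrightarrow> g x = f x"
    using linear_between_extend[OF assms(1,2)] by metis
  interpret g: Vector_Spaces.linear scale scale g by fact
  have im: "f ` A = g ` A" using gf by auto
  obtain b where b: "b \<subseteq> A" "independent b" "A \<subseteq> span b" "card b = dim A"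
    using basis_exists[of A] by metis
  have sb: "span b = A" by (simp add: b assms(2) span_subspace)
  have inj: "inj_on g A" using assms(3) gf by (metis inj_on_cong)
  have "independent (g ` b)"
    using linear_independent_injective_image[OF g b(2)] inj sb by simp
  moreover have "g ` A \<subseteq> span (g ` b)" using b(3) by (metis g.span_image image_mono)
  ultimately have "card (g ` b) = dim (g ` A)"
    using b(1) by (intro basis_card_eq_dim) auto
  moreover have "card (g ` b) = card b" using inj b(1) by (metis card_image inj_on_subset)
  ultimately show ?thesis using b(4) im by simp
qed

lemma linear_between_diff:
  assumes "linear_between scale A C f" "subspace A" "u \<in> A" "w \<in> A"
  shows "f (u - w) = f u - f w"
proof -
  have "f (u - w) + f w = f u"
    using assms by (metis diff_add_cancel linear_between_def subspace_diff)
  then show ?thesis by (simp add: eq_diff_eq)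
qed

lemma linear_between_zero:
  assumes "linear_between scale A C f" "subspace A"
  shows "f 0 = 0"
  using linear_between_diff[OF assms, of 0 0] subspace_0[OF assms(2)] by simp

lemma linear_between_subspace_image:
  assumes "linear_between scale A C f" "subspace A" "subspace D" "D \<subseteq> A"
  shows "subspace (f ` D)"
proof -
  have f: "f (u + w) = f u + f w" "f (c *s u) = c *s f u" if "u \<in> D" "w \<in> D" for u w c
    using assms(1) subsetD[OF assms(4)] that by (auto simp: linear_between_def)
  show ?thesis
    unfolding subspace_def
    using assms(3) f linear_between_zero[OF assms(1,2)]
    by (auto simp: subspace_def image_iff) metis+
qed

lemma linear_between_subspace_vimage:
  assumes "linear_between scale A C f" "subspace A" "subspace D"
  shows "subspace {u \<in> A. f u \<in> D}"
proof -
  have "f (u + w) = f u + f w" "f (c *s u) = c *s f u" if "u \<in> A" "w \<in> A" for u w c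
    using assms(1) that by (auto simp: linear_between_def)
  then show ?thesis
    unfolding subspace_def
    using assms(2,3) linear_between_zero[OF assms(1,2)]
    by (auto simp: subspace_def)
qed

end

section \<open>Splitting a representation of a ray\<close>

text \<open>For a subspace \<open>C\<close> contained in the direct sum of \<open>P\<close> and
  \<open>R\<close> this is the compatibility \<open>C = (C \<inter> P) + (C \<inter> R)\<close>. The
  form with sums \<open>p + r \<in> C\<close> also makes sense while \<open>P\<close> and
  \<open>R\<close> do not yet fill the space.\<close>

definition respects_splitting :: "'w::ab_group_add set \<Rightarrow> 'w set \<Rightarrow> 'w set \<Rightarrow> bool" where
  "respects_splitting P R C \<longleftrightarrow> (\<forall>p\<in>P. \<forall>r\<in>R. p + r \<in> C \<longrightarrow> p \<in> C \<and> r \<in> C)"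

lemma respects_splitting_commute: "respects_splitting P R C \<Longrightarrow> respects_splitting R P C"
  unfolding respects_splitting_def by (metis add.commute)

context vector_space
begin

definition complementary :: "'b set \<Rightarrow> 'b set \<Rightarrow> 'b set \<Rightarrow> bool" where
  "complementary U P R \<longleftrightarrow>
     subspace P \<and> subspace R \<and> P \<subseteq> U \<and> R \<subseteq> U \<and> P \<inter> R = {0} \<and>
     (\<forall>u\<in>U. \<exists>p\<in>P. \<exists>r\<in>R. u = p + r)"

definition subspace_chain :: "'b set \<Rightarrow> 'b set set \<Rightarrow> bool" where
  "subspace_chain U \<C> \<longleftrightarrow>
     U \<in> \<C> \<and> (\<forall>C\<in>\<C>. subspace C \<and> C \<subseteq> U) \<and> (\<forall>C\<in>\<C>. \<forall>D\<in>\<C>. C \<subseteq> D \<or> D \<subseteq> C)"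

text \<open>
  The edge between the vertices \<open>n\<close> and \<open>n + 1\<close> of the ray points away from vertex \<open>0\<close> iff \<open>out n\<close>.
  The traces at \<open>n\<close> are pulled back along the ray from \<open>0\<close> and the full spaces at the later vertices;
  a splitting at \<open>n\<close> that respects all of them can be continued to \<open>n + 1\<close>.
\<close>

inductive_set trace :: "(nat \<Rightarrow> 'b set) \<Rightarrow> (nat \<Rightarrow> bool) \<Rightarrow> (nat \<Rightarrow> 'b \<Rightarrow> 'b) \<Rightarrow> (nat \<times> 'b set) set"
  for U "out" F where
  trace_zero: "(n, {0}) \<in> trace U out F"
| trace_full: "(n, U n) \<in> trace U out F"
| trace_out: "out n \<Longrightarrow> (Suc n, C) \<in> trace U out F \<Longrightarrow> (n, {u \<in> U n. F n u \<in> C}) \<in> trace U out F"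
| trace_in: "\<not> out n \<Longrightarrow> (Suc n, C) \<in> trace U out F \<Longrightarrow> (n, F n ` C) \<in> trace U out F"

end

section \<open>Complements compatible with a chain of subspaces\<close>

context vector_space
begin

lemma complementary_commute: "complementary U P R \<Longrightarrow> complementary U R P"
  unfolding complementary_def by (metis add.commute Int_commute)

text \<open>
  Taking the new vector from a minimal member of the chain that is not yet covered keeps the
  splitting compatible with all the other members.
\<close>

lemma enlarge_summand:
  assumes fd: "finite B" "U \<subseteq> span B" and chain: "subspace_chain U \<C>"
    and P: "subspace P" "P \<subseteq> X" and R: "subspace R" "R \<subseteq> U" "P \<inter> R = {0}"
    and X: "subspace X" "X \<subseteq> U"
    and split: "\<And>C. C \<in> \<C> \<Longrightarrow> respects_splitting P R C"
    and cover: "\<And>C c. C \<in> \<C> \<Longrightarrow> c \<in> C \<Longrightarrow> \<exists>x\<in>C \<inter> X. c - x \<in> R"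
    and not_all: "\<not> (\<forall>u\<in>U. \<exists>p\<in>P. \<exists>r\<in>R. u = p + r)"
  obtains P' where "subspace P'" "P \<subset> P'" "P' \<subseteq> X" "P' \<inter> R = {0}"
    "\<forall>C\<in>\<C>. respects_splitting P' R C"
proof -
  have sub: "subspace C" "C \<subseteq> U" if "C \<in> \<C>" for C
    using chain that by (auto simp: subspace_chain_def)
  define S where "S = {p + r |p r. p \<in> P \<and> r \<in> R}"
  have S: "subspace S" unfolding S_def by (rule subspace_sums) fact+
  have "\<exists>C. C \<in> \<C> \<and> \<not> C \<subseteq> S"
    using not_all chain by (auto simp: S_def subspace_chain_def)
  then obtain C where C: "C \<in> \<C>" "\<not> C \<subseteq> S"
    and least: "\<And>D. D \<in> \<C> \<Longrightarrow> \<not> D \<subseteq> S \<Longrightarrow> dim C \<le> dim D"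
    using ex_has_least_nat[of "\<lambda>C. C \<in> \<C> \<and> \<not> C \<subseteq> S" _ dim] by metis
  obtain c where c: "c \<in> C" "c \<notin> S" using C(2) by blast
  \<comment> \<open>The vector \<open>c\<close> may lie outside \<open>X\<close>. Replacing it by
    \<open>x\<close>, which differs from it by an element of \<open>R\<close>, stays in
    \<open>C\<close> and outside \<open>S\<close>.\<close>
  obtain x where x: "x \<in> C" "x \<in> X" "c - x \<in> R" using cover[OF C(1) c(1)] by blast
  have RS: "r \<in> S" if "r \<in> R" for r
    using that subspace_0[OF P(1)] unfolding S_def by force
  have PS: "p \<in> S" if "p \<in> P" for p
    using that subspace_0[OF R(1)] unfolding S_def by force
  have xS: "x \<notin> S"
  proof
    assume "x \<in> S"
    then have "x + (c - x) \<in> S" using RS x(3) S subspace_add by blast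
    then show False using c(2) by simp
  qed
  have multS: "k = 0" if "k *s x \<in> S" for k
  proof (rule ccontr)
    assume "k \<noteq> 0"
    then have "x = inverse k *s (k *s x)" by simp
    then show False using xS that S by (metis subspace_scale)
  qed
  define P' where "P' = {p + q |p q. p \<in> P \<and> q \<in> range (\<lambda>k. k *s x)}"
  have mem: "p + k *s x \<in> P'" if "p \<in> P" for p k
    using that unfolding P'_def by blast
  have elim: "\<exists>p\<in>P. \<exists>k. y = p + k *s x" if "y \<in> P'" for y
    using that unfolding P'_def by blast
  show thesis
  proof (rule that)
    have "subspace (range (\<lambda>k. k *s x))"
      using subspace_span[of "{x}"] by (simp add: span_singleton)
    then show "subspace P'" unfolding P'_def using P(1) by (intro subspace_sums)
    have "P \<subseteq> P'" using mem[of _ 0] by auto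
    moreover have "x \<in> P'" using mem[of 0 1] subspace_0[OF P(1)] by simp
    ultimately show "P \<subset> P'" using PS xS by blast
    show "P' \<subseteq> X" using elim P(2) x(2) X(1) by (metis subsetD subsetI subspace_add subspace_scale)
    show "P' \<inter> R = {0}"
    proof
      show "P' \<inter> R \<subseteq> {0}"
      proof
        fix y assume y: "y \<in> P' \<inter> R"
        then obtain p k where pk: "p \<in> P" "y = p + k *s x" using elim by blast
        then have "k *s x = y - p" by simp
        then have "k *s x \<in> S" using y PS RS pk(1) S by (metis IntD2 subspace_diff)
        then have "y = p" using multS pk by simp
        then show "y \<in> {0}" using pk y R(3) by blast
      qed
      show "{0} \<subseteq> P' \<inter> R" using \<open>P \<subseteq> P'\<close> P(1) R(1) by (auto simp: subspace_0)
    qed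
    show "\<forall>D\<in>\<C>. respects_splitting P' R D"
    proof
      fix D assume D: "D \<in> \<C>"
      \<comment> \<open>If \<open>x \<in> D\<close>, the multiple of \<open>x\<close> can be
        subtracted and the old compatibility applies. If not, \<open>D\<close> lies strictly inside
        \<open>C\<close>, so \<open>D \<subseteq> S\<close> by minimality, which leaves only the
        zero multiple of \<open>x\<close>.\<close>
      have "p + k *s x \<in> D" if p: "p \<in> P" and r: "r \<in> R" and inD: "p + k *s x + r \<in> D" for p k r
      proof (cases "x \<in> D")
        case True
        then have "p + k *s x + r - k *s x \<in> D"
          using inD sub(1)[OF D] by (intro subspace_diff subspace_scale)
        then have "p + r \<in> D" by (simp add: algebra_simps)
        then have "p \<in> D" using split[OF D] p r by (auto simp: respects_splitting_def)
        then show ?thesis using True sub(1)[OF D] by (intro subspace_add subspace_scale)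
      next
        case False
        then have "D \<subset> C" using chain C(1) D x(1) unfolding subspace_chain_def by blast
        then have "dim D < dim C"
          using dim_less_of_psubset[OF fd(1)] sub C(1) D fd(2) by (meson order_trans)
        then have "D \<subseteq> S" using least[OF D] by fastforce
        then have "p + k *s x + r - p - r \<in> S"
          using inD PS[OF p] RS[OF r] S by (intro subspace_diff) auto
        then have "k = 0" using multS by simp
        then show ?thesis using inD split[OF D] p r by (auto simp: respects_splitting_def)
      qed
      moreover have "r \<in> D" if "q + r \<in> D" "q \<in> D" for q r
        using subspace_diff[OF sub(1)[OF D] that] by simp
      ultimately show "respects_splitting P' R D"
        unfolding respects_splitting_def using elim by metis
    qed
  qed
qed

text \<open>Among the compatible subspaces between \<open>P\<close> and \<open>X\<close> that meet
  \<open>R\<close> trivially, one of largest dimension complements \<open>R\<close>, since otherwise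
  \<open>enlarge_summand\<close> would enlarge it. \<open>X\<close> prescribes where the complement
  has to lie; by \<open>cover\<close>, each element of a member \<open>C\<close> of the chain is
  congruent modulo \<open>R\<close> to an element of \<open>C \<inter> X\<close>.\<close>

lemma extend_splitting:
  assumes fd: "finite B" "U \<subseteq> span B" and chain: "subspace_chain U \<C>"
    and P: "subspace P" "P \<subseteq> X" and R: "subspace R" "R \<subseteq> U" "P \<inter> R = {0}"
    and X: "subspace X" "X \<subseteq> U"
    and split: "\<And>C. C \<in> \<C> \<Longrightarrow> respects_splitting P R C"
    and cover: "\<And>C c. C \<in> \<C> \<Longrightarrow> c \<in> C \<Longrightarrow> \<exists>x\<in>C \<inter> X. c - x \<in> R"
  obtains P' where "P \<subseteq> P'" "P' \<subseteq> X" "complementary U P' R"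
    "\<forall>C\<in>\<C>. respects_splitting P' R C"
proof -
  define good where "good P' \<longleftrightarrow> subspace P' \<and> P \<subseteq> P' \<and> P' \<subseteq> X \<and> P' \<inter> R = {0} \<and>
      (\<forall>C\<in>\<C>. respects_splitting P' R C)" for P'
  have "good P" using assms by (auto simp: good_def)
  moreover have "dim P' < Suc (card B)" if "good P'" for P'
    using dim_le_card[of P' B] that X(2) fd by (auto simp: good_def less_Suc_eq_le)
  ultimately obtain P' where P': "good P'" and max: "\<And>P''. good P'' \<Longrightarrow> dim P'' \<le> dim P'"
    using ex_has_greatest_nat[of good P dim "Suc (card B)"] by blast
  then have sub: "subspace P'" "P \<subseteq> P'" "P' \<subseteq> X" "P' \<inter> R = {0}"
      "\<And>C. C \<in> \<C> \<Longrightarrow> respects_splitting P' R C"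
    by (simp_all add: good_def)
  have all: "\<forall>u\<in>U. \<exists>p\<in>P'. \<exists>r\<in>R. u = p + r"
  proof (rule ccontr)
    assume not_all: "\<not> ?thesis"
    obtain P'' where P'': "subspace P''" "P' \<subset> P''" "P'' \<subseteq> X" "P'' \<inter> R = {0}"
        "\<forall>C\<in>\<C>. respects_splitting P'' R C"
      using enlarge_summand[OF fd chain sub(1,3) R(1,2) sub(4) X sub(5) cover not_all] by metis
    have "dim P' < dim P''"
      using dim_less_of_psubset[OF fd(1) _ sub(1) P''(2)] P''(3) X(2) fd(2) by (meson order_trans)
    moreover have "good P''" using P'' sub(2) unfolding good_def by (meson order_trans psubset_imp_subset)
    ultimately show False using max by fastforce
  qed
  have "P' \<subseteq> U" using sub(3) X(2) by (rule order_trans)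
  then have "complementary U P' R"
    unfolding complementary_def using sub(1,4) R(1,2) all by (intro conjI)
  then show thesis using that sub(2,3,5) by simp
qed

text \<open>The image of \<open>P\<close> is forced as the new summand, and the image of
  \<open>R\<close> is extended to a complement of it. The two images are independent because
  \<open>{0}\<close> is a member of the chain, so that the kernel of \<open>F\<close> respects the
  old splitting.\<close>

lemma splitting_step_forward:
  assumes fd: "finite B" "U' \<subseteq> span B" and chain: "subspace_chain U' \<C>'" "{0} \<in> \<C>'"
    and U: "subspace U" and F: "linear_between scale U U' F"
    and vimage: "\<And>C. C \<in> \<C>' \<Longrightarrow> {u \<in> U. F u \<in> C} \<in> \<C>"
    and PR: "complementary U P R" and split: "\<And>C. C \<in> \<C> \<Longrightarrow> respects_splitting P R C"
  obtains R' where "complementary U' (F ` P) R'" "F ` R \<subseteq> R'"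
    "\<forall>C\<in>\<C>'. respects_splitting (F ` P) R' C"
proof -
  have PRU: "subspace P" "subspace R" "P \<subseteq> U" "R \<subseteq> U" using PR by (auto simp: complementary_def)
  have U': "subspace U'" using chain by (auto simp: subspace_chain_def)
  have FU: "F ` U \<subseteq> U'" using F by (auto simp: linear_between_def)
  have split': "respects_splitting (F ` R) (F ` P) C" if C: "C \<in> \<C>'" for C
    unfolding respects_splitting_def
  proof (intro ballI impI)
    fix y z assume y: "y \<in> F ` R" and z: "z \<in> F ` P" and inC: "y + z \<in> C"
    from y z obtain r p where rp: "r \<in> R" "p \<in> P" "y = F r" "z = F p" by blast
    then have "F (p + r) = z + y"
      using F subsetD[OF PRU(3)] subsetD[OF PRU(4)] by (auto simp: linear_between_def)
    moreover have "p + r \<in> U" using rp PRU U by (auto intro: subspace_add)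
    ultimately have "p + r \<in> {u \<in> U. F u \<in> C}" using inC by (simp add: add.commute)
    then show "y \<in> C \<and> z \<in> C"
      using split[OF vimage[OF C]] rp by (auto simp: respects_splitting_def)
  qed
  have 0: "F ` R \<inter> F ` P = {0}"
  proof
    show "F ` R \<inter> F ` P \<subseteq> {0}"
    proof
      fix y assume y: "y \<in> F ` R \<inter> F ` P"
      then have "- y \<in> F ` P"
        using linear_between_subspace_image[OF F U PRU(1,3)] by (intro subspace_neg) auto
      moreover have "y + - y \<in> {0}" by simp
      ultimately show "y \<in> {0}"
        using split'[OF chain(2)] y unfolding respects_splitting_def by blast
    qed
    show "{0} \<subseteq> F ` R \<inter> F ` P"
      using linear_between_subspace_image[OF F U] PRU by (simp add: subspace_0)
  qed
  have FPR: "F ` P \<subseteq> U'" "F ` R \<subseteq> U'" using FU PRU by blast+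
  \<comment> \<open>The roles are exchanged: the image of \<open>R\<close> grows while the image of
    \<open>P\<close> stays fixed. With \<open>X = U'\<close> each \<open>c\<close> represents
    itself.\<close>
  obtain R' where R': "F ` R \<subseteq> R'" "complementary U' R' (F ` P)"
      "\<forall>C\<in>\<C>'. respects_splitting R' (F ` P) C"
  proof (rule extend_splitting[OF fd chain(1), of "F ` R" U' "F ` P"])
    show "\<exists>x\<in>C \<inter> U'. c - x \<in> F ` P" if "C \<in> \<C>'" "c \<in> C" for C c
      using that chain 0 by (intro bexI[of _ c]) (auto simp: subspace_chain_def)
  qed (use linear_between_subspace_image[OF F U] PRU FPR U' 0 split' in auto)
  then show thesis
    using that[OF complementary_commute[OF R'(2)]] respects_splitting_commute by blast
qed

text \<open>The full preimage of \<open>R\<close> becomes the new \<open>R\<close>; it contains the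
  kernel of \<open>F\<close>, so \<open>F\<close> is injective on every complement. The new
  \<open>P\<close> is built up from \<open>{0}\<close> inside the preimage of \<open>P\<close>,
  which ensures that \<open>F\<close> maps it into \<open>P\<close>.\<close>

lemma splitting_step_backward:
  assumes fd: "finite B" "U' \<subseteq> span B" and chain: "subspace_chain U' \<C>'"
    and F: "linear_between scale U' U F"
    and image: "\<And>C. C \<in> \<C>' \<Longrightarrow> F ` C \<in> \<C>"
    and PR: "complementary U P R" and split: "\<And>C. C \<in> \<C> \<Longrightarrow> respects_splitting P R C"
  obtains P' where "complementary U' P' {u \<in> U'. F u \<in> R}" "F ` P' \<subseteq> P"
    "\<forall>C\<in>\<C>'. respects_splitting P' {u \<in> U'. F u \<in> R} C"
proof -
  have PRU: "subspace P" "subspace R" "P \<subseteq> U" "R \<subseteq> U"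
    and sum: "\<And>u. u \<in> U \<Longrightarrow> \<exists>p\<in>P. \<exists>r\<in>R. u = p + r"
    using PR by (auto simp: complementary_def)
  have U': "subspace U'" using chain by (auto simp: subspace_chain_def)
  have FU: "F ` U' \<subseteq> U" using F by (auto simp: linear_between_def)
  let ?R = "{u \<in> U'. F u \<in> R}" and ?X = "{u \<in> U'. F u \<in> P}"
  have sub: "subspace ?R" "subspace ?X"
    using linear_between_subspace_vimage[OF F U'] PRU by auto
  obtain P' where "{0} \<subseteq> P'" "P' \<subseteq> ?X" "complementary U' P' ?R"
      "\<forall>C\<in>\<C>'. respects_splitting P' ?R C"
  proof (rule extend_splitting[OF fd chain, of "{0}" ?X ?R])
    show "respects_splitting {0} ?R C" if "C \<in> \<C>'" for C
      using that chain by (auto simp: respects_splitting_def subspace_chain_def subspace_0)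
    \<comment> \<open>The image of \<open>C\<close> respects the old splitting, so the component
      \<open>p\<close> of \<open>F c\<close> is the image of some \<open>x \<in> C\<close>; what
      remains of \<open>c\<close> is sent into \<open>R\<close>.\<close>
    show "\<exists>x\<in>C \<inter> ?X. c - x \<in> ?R" if C: "C \<in> \<C>'" and c: "c \<in> C" for C c
    proof -
      have CU: "C \<subseteq> U'" using chain C by (auto simp: subspace_chain_def)
      then obtain p r where pr: "p \<in> P" "r \<in> R" "F c = p + r" using sum FU c by blast
      then have "p \<in> F ` C"
        using split[OF image[OF C]] c unfolding respects_splitting_def by (metis imageI)
      then obtain x where x: "x \<in> C" "F x = p" by blast
      then have "F (c - x) = r"
        using linear_between_diff[OF F U', of c x] CU c pr(3) by auto
      then show ?thesis
        using x pr c CU U' by (intro bexI[of _ x]) (auto intro: subspace_diff)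
    qed
  qed (use sub subspace_0[OF sub(1)] subspace_0[OF sub(2)] in auto)
  then show thesis using that by blast
qed

section \<open>Splittings along the whole ray\<close>

context
  fixes U :: "nat \<Rightarrow> 'b set" and "out" :: "nat \<Rightarrow> bool" and F :: "nat \<Rightarrow> 'b \<Rightarrow> 'b"
  assumes U: "\<And>n. subspace (U n)"
    and fd: "\<And>n. \<exists>B. finite B \<and> U n \<subseteq> span B"
    and F_out: "\<And>n. out n \<Longrightarrow> linear_between scale (U n) (U (Suc n)) (F n)"
    and F_in: "\<And>n. \<not> out n \<Longrightarrow> linear_between scale (U (Suc n)) (U n) (F n)"
begin

lemma trace_subspace: "(n, C) \<in> trace U out F \<Longrightarrow> subspace C \<and> C \<subseteq> U n"
proof (induction rule: trace.induct)
  case (trace_zero n)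
  then show ?case using U by (simp add: subspace_0)
next
  case (trace_full n)
  then show ?case using U by simp
next
  case (trace_out n C)
  then show ?case using linear_between_subspace_vimage[OF F_out U] by auto
next
  case (trace_in n C)
  then have "F n ` C \<subseteq> F n ` U (Suc n)" by blast
  also have "\<dots> \<subseteq> U n" using F_in[OF trace_in(1)] by (simp add: linear_between_def)
  finally show ?case using trace_in linear_between_subspace_image[OF F_in U] by simp
qed

text \<open>\<open>{0}\<close> and \<open>U n\<close> are comparable with every subspace of
  \<open>U n\<close>. Any other trace comes through the edge between \<open>n\<close> and
  \<open>Suc n\<close>, whose direction decides whether it is a preimage or an image; both
  operations preserve inclusions, so comparability is inherited from \<open>Suc n\<close>.\<close>

lemma trace_total:
  "(n, C) \<in> trace U out F \<Longrightarrow> (n, D) \<in> trace U out F \<Longrightarrow> C \<subseteq> D \<or> D \<subseteq> C"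
proof (induction arbitrary: D rule: trace.induct)
  case (trace_zero n)
  then show ?case using trace_subspace[OF trace_zero] by (simp add: subspace_0)
next
  case (trace_full n)
  then show ?case using trace_subspace[OF trace_full] by simp
next
  case (trace_out n C)
  note C = trace_out
  have "subspace {u \<in> U n. F n u \<in> C}"
    using trace_subspace[OF trace.trace_out[OF C(1,2)]] by simp
  then have 0: "0 \<in> {u \<in> U n. F n u \<in> C}" by (rule subspace_0)
  from C(4) show ?case
  proof cases
    case (trace_out C')
    then show ?thesis using C(3)[of C'] by auto
  qed (use 0 C(1) in auto)
next
  case (trace_in n C)
  note C = trace_in
  have "subspace (F n ` C)" "F n ` C \<subseteq> U n"
    using trace_subspace[OF trace.trace_in[OF C(1,2)]] by auto
  moreover then have "0 \<in> F n ` C" by (simp add: subspace_0)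
  moreover note 0 = calculation
  from C(4) show ?case
  proof cases
    case (trace_in C')
    then show ?thesis using C(3)[of C'] by auto
  qed (use 0 C(1) in auto)
qed

lemma trace_chain: "subspace_chain (U n) {C. (n, C) \<in> trace U out F}"
  using trace_subspace trace_total by (auto simp: subspace_chain_def intro: trace_full)

text \<open>The splitting is chosen vertex by vertex. Compatibility with all traces at
  \<open>n\<close> is the invariant: traces at \<open>Suc n\<close> are transported to traces at
  \<open>n\<close>, so the forward or the backward step applies and reproduces it.\<close>

lemma ray_splitting:
  obtains P R where "\<forall>n. complementary (U n) (P n) (R n)" "R 0 = {0}"
    "\<forall>n. out n \<longrightarrow> F n ` P n = P (Suc n) \<and> F n ` R n \<subseteq> R (Suc n)"
    "\<forall>n. \<not> out n \<longrightarrow> F n ` P (Suc n) \<subseteq> P n \<and> inj_on (F n) (P (Suc n)) \<and> F n ` R (Suc n) \<subseteq> R n"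
proof -
  define good where "good n PR \<longleftrightarrow> complementary (U n) (fst PR) (snd PR) \<and>
      (\<forall>C. (n, C) \<in> trace U out F \<longrightarrow> respects_splitting (fst PR) (snd PR) C) \<and>
      (n = 0 \<longrightarrow> snd PR = {0})" for n PR
  \<comment> \<open>For an arrow towards \<open>0\<close>, \<open>step\<close> records that the new
    \<open>R\<close> is the full preimage of the old one; injectivity on \<open>P\<close> is derived
    from this below.\<close>
  define step where "step n PR PR' \<longleftrightarrow>
      (out n \<longrightarrow> F n ` fst PR = fst PR' \<and> F n ` snd PR \<subseteq> snd PR') \<and>
      (\<not> out n \<longrightarrow> F n ` fst PR' \<subseteq> fst PR \<and> snd PR' = {u \<in> U (Suc n). F n u \<in> snd PR})"
    for n PR PR'
  have "\<exists>f. \<forall>n. good n (f n) \<and> step n (f n) (f (Suc n))"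
  proof (rule dependent_nat_choice)
    \<comment> \<open>With \<open>R = {0}\<close> every trace is respected, so the construction can
      start from \<open>P = U 0\<close>.\<close>
    have "good 0 (U 0, {0})"
      using U trace_subspace
      by (auto simp: good_def complementary_def respects_splitting_def subspace_0)
    then show "\<exists>PR. good 0 PR" ..
  next
    fix PR n assume "good n PR"
    then obtain P R where PR: "PR = (P, R)" "complementary (U n) P R"
        "\<And>C. (n, C) \<in> trace U out F \<Longrightarrow> respects_splitting P R C"
      by (cases PR) (auto simp: good_def)
    obtain B where B: "finite B" "U (Suc n) \<subseteq> span B" using fd by blast
    define \<C> where "\<C> n = {C. (n, C) \<in> trace U out F}" for n
    have chain: "subspace_chain (U n) (\<C> n)" for n using trace_chain by (simp add: \<C>_def)
    have split: "C \<in> \<C> n \<Longrightarrow> respects_splitting P R C" for C using PR(3) by (simp add: \<C>_def)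
    show "\<exists>PR'. good (Suc n) PR' \<and> step n PR PR'"
    proof (cases "out n")
      case True
      have zero: "{0} \<in> \<C> (Suc n)"
        and vimage: "C \<in> \<C> (Suc n) \<Longrightarrow> {u \<in> U n. F n u \<in> C} \<in> \<C> n" for C
        using True by (auto simp: \<C>_def intro: trace_zero trace_out)
      obtain R' where "complementary (U (Suc n)) (F n ` P) R'" "F n ` R \<subseteq> R'"
          "\<forall>C\<in>\<C> (Suc n). respects_splitting (F n ` P) R' C"
        by (rule splitting_step_forward[OF B chain zero U F_out[OF True] vimage PR(2) split]) blast+
      then have "good (Suc n) (F n ` P, R') \<and> step n PR (F n ` P, R')"
        using True PR(1) by (simp add: good_def step_def \<C>_def)
      then show ?thesis ..
    next
      case False
      let ?R = "{u \<in> U (Suc n). F n u \<in> R}"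
      have image: "C \<in> \<C> (Suc n) \<Longrightarrow> F n ` C \<in> \<C> n" for C
        using False by (auto simp: \<C>_def intro: trace_in)
      obtain P' where "complementary (U (Suc n)) P' ?R" "F n ` P' \<subseteq> P"
          "\<forall>C\<in>\<C> (Suc n). respects_splitting P' ?R C"
        by (rule splitting_step_backward[OF B chain F_in[OF False] image PR(2) split]) blast+
      then have "good (Suc n) (P', ?R) \<and> step n PR (P', ?R)"
        using False PR(1) by (simp add: good_def step_def \<C>_def)
      then show ?thesis ..
    qed
  qed
  then obtain f where f: "\<And>n. good n (f n)" "\<And>n. step n (f n) (f (Suc n))" by blast
  define P where "P n = fst (f n)" for n
  define R where "R n = snd (f n)" for n
  have compl: "complementary (U n) (P n) (R n)" for n
    using f(1)[of n] by (simp add: good_def P_def R_def)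
  have fwd: "F n ` P n = P (Suc n) \<and> F n ` R n \<subseteq> R (Suc n)" if "out n" for n
    using f(2)[of n] that by (simp add: step_def P_def R_def)
  have bwd: "F n ` P (Suc n) \<subseteq> P n \<and> inj_on (F n) (P (Suc n)) \<and> F n ` R (Suc n) \<subseteq> R n"
    if "\<not> out n" for n
  proof -
    have P: "F n ` P (Suc n) \<subseteq> P n" and R: "R (Suc n) = {u \<in> U (Suc n). F n u \<in> R n}"
      and lin: "linear_between scale (U (Suc n)) (U n) (F n)"
      using f(2)[of n] F_in that by (auto simp: step_def P_def R_def)
    have sub: "subspace (P (Suc n))" "P (Suc n) \<subseteq> U (Suc n)" "P (Suc n) \<inter> R (Suc n) = {0}" "0 \<in> R n"
      using compl subspace_0 unfolding complementary_def by auto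
    \<comment> \<open>The kernel of \<open>F n\<close> lies in \<open>R (Suc n)\<close>, which meets
      \<open>P (Suc n)\<close> only in \<open>0\<close>.\<close>
    have "inj_on (F n) (P (Suc n))"
    proof (rule inj_onI)
      fix u w assume uw: "u \<in> P (Suc n)" "w \<in> P (Suc n)" "F n u = F n w"
      then have "F n (u - w) = 0"
        using linear_between_diff[OF lin U, of u w] sub(2) by auto
      moreover have "u - w \<in> P (Suc n)" using uw sub(1) by (simp add: subspace_diff)
      ultimately have "u - w \<in> P (Suc n) \<inter> R (Suc n)"
        using sub(2,4) unfolding R by auto
      then have "u - w = 0" unfolding sub(3) by simp
      then show "u = w" by simp
    qed
    with P R show ?thesis by blast
  qed
  have "R 0 = {0}" using f(1)[of 0] by (simp add: good_def R_def)
  with compl fwd bwd show thesis by (intro that[of P R]) simp_all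
qed

text \<open>Surjective outward arrows and injective inward arrows both make \<open>dim (U n)\<close>
  weakly decreasing in \<open>n\<close>. From an index of least dimension on it is constant, and a
  surjective or injective linear map between spaces of equal finite dimension is bijective.\<close>

lemma eventually_bij_of_monotone:
  assumes out_surj: "\<And>n. out n \<Longrightarrow> F n ` U n = U (Suc n)"
    and in_inj: "\<And>n. \<not> out n \<Longrightarrow> inj_on (F n) (U (Suc n))"
  obtains M where "\<forall>n\<ge>M. out n \<longrightarrow> bij_betw (F n) (U n) (U (Suc n))"
    "\<forall>n\<ge>M. \<not> out n \<longrightarrow> bij_betw (F n) (U (Suc n)) (U n)"
proof -
  have decr: "dim (U (Suc n)) \<le> dim (U n)" for n
  proof -
    obtain B where B: "finite B" "U n \<subseteq> span B" using fd by blast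
    show ?thesis
    proof (cases "out n")
      case True
      then show ?thesis using dim_linear_image_le(1)[OF F_out U B] out_surj by metis
    next
      case False
      have "F n ` U (Suc n) \<subseteq> U n" using F_in[OF False] by (auto simp: linear_between_def)
      then show ?thesis
        using dim_inj_image[OF F_in U] in_inj dim_le_of_subset[OF B] False by metis
    qed
  qed
  obtain M where M: "\<And>n. dim (U M) \<le> dim (U n)"
    using ex_has_least_nat[of "\<lambda>_. True" _ "\<lambda>n. dim (U n)"] by blast
  \<comment> \<open>Monotonicity gives \<open>dim (U n) \<le> dim (U M)\<close>, and minimality
    gives \<open>dim (U M) \<le> dim (U (Suc n))\<close>.\<close>
  have "dim (U n) \<le> dim (U (Suc n))" if "M \<le> n" for n
    using M[of "Suc n"] lift_Suc_antimono_le[of "\<lambda>n. dim (U n)", OF decr that] by simp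
  note le = this
  have bij: "(out n \<longrightarrow> bij_betw (F n) (U n) (U (Suc n))) \<and>
      (\<not> out n \<longrightarrow> bij_betw (F n) (U (Suc n)) (U n))" if n: "M \<le> n" for n
  proof (intro conjI impI)
    obtain B where B: "finite B" "U n \<subseteq> span B" using fd by blast
    show "bij_betw (F n) (U n) (U (Suc n))" if "out n"
      using dim_linear_image_le(2)[OF F_out[OF that] U B] out_surj[OF that] le[OF n]
      by (simp add: bij_betw_def)
    show "bij_betw (F n) (U (Suc n)) (U n)" if "\<not> out n"
    proof -
      have "subspace (F n ` U (Suc n))" "F n ` U (Suc n) \<subseteq> U n"
        using linear_between_subspace_image[OF F_in[OF that] U U] F_in[OF that]
        by (auto simp: linear_between_def)
      then have "F n ` U (Suc n) = U n"
        using subspace_eq_of_dim_le[OF B] dim_inj_image[OF F_in[OF that] U in_inj[OF that]] le[OF n]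
        by metis
      then show ?thesis using in_inj[OF that] by (simp add: bij_betw_def)
    qed
  qed
  then show thesis using that by blast
qed

end

end

section \<open>Rays in tree quivers\<close>

definition adjacent :: "'v pair_pre_digraph \<Rightarrow> 'v \<Rightarrow> 'v \<Rightarrow> bool" where
  "adjacent Q x y \<longleftrightarrow> (x, y) \<in> parcs Q \<or> (y, x) \<in> parcs Q"

lemma adjacent_sym: "adjacent Q x y \<Longrightarrow> adjacent Q y x"
  by (auto simp: adjacent_def)

lemma adjacent_in_pverts:
  assumes "tree_quiver Q" "adjacent Q x y"
  shows "x \<in> pverts Q" "y \<in> pverts Q"
  using assms pair_wf_digraph.in_arcsD1 pair_wf_digraph.in_arcsD2
  unfolding tree_quiver_def adjacent_def by fast+

text \<open>Opposite arrows form a cycle of length 2. The case \<open>x = y\<close> is a cycle of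
  length 1, so loops are excluded as well.\<close>

lemma tree_quiver_antisym:
  assumes "tree_quiver Q" "(x, y) \<in> parcs Q"
  shows "(y, x) \<notin> parcs Q"
proof
  assume yx: "(y, x) \<in> parcs Q"
  have verts: "x \<in> pverts Q" "y \<in> pverts Q"
    using adjacent_in_pverts[OF assms(1), of x y] assms(2) by (auto simp: adjacent_def)
  have "underlying_cycle Q [x] [(x, x)]" if "x = y"
    using assms(2) verts that by (auto simp: underlying_cycle_def)
  moreover have "underlying_cycle Q [x, y] [(x, y), (y, x)]" if "x \<noteq> y"
    using assms(2) yx verts that by (auto simp: underlying_cycle_def less_Suc_eq)
  ultimately show False using assms(1) by (auto simp: tree_quiver_def)
qed

text \<open>Adjacency forgets which arrow joins two vertices, so an arrow is chosen for each pair of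
  cyclic neighbours. Length at least 3 makes these arrows distinct; a list of length 2 could use a
  single arrow twice.\<close>

lemma tree_quiver_no_cycle:
  assumes tree: "tree_quiver Q" and vs: "distinct vs" "3 \<le> length vs"
    and adj: "successively (adjacent Q) vs" "adjacent Q (last vs) (hd vs)"
  shows False
proof -
  define n where "n = length vs"
  define nxt where "nxt i = Suc i mod n" for i
  define e where "e i = (if (vs ! i, vs ! nxt i) \<in> parcs Q then (vs ! i, vs ! nxt i)
      else (vs ! nxt i, vs ! i))" for i
  have n: "3 \<le> n" using vs by (simp add: n_def)
  have nxt: "nxt i = (if Suc i = n then 0 else Suc i)" if "i < n" for i
    using that by (auto simp: nxt_def)
  have adj': "adjacent Q (vs ! i) (vs ! nxt i)" if "i < n" for i
  proof (cases "Suc i = n")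
    case True
    then have "i = length vs - 1" "nxt i = 0" "vs \<noteq> []" using n nxt[OF that] by (auto simp: n_def)
    then have "vs ! i = last vs" "vs ! nxt i = hd vs" by (simp_all add: last_conv_nth hd_conv_nth)
    then show ?thesis using adj by simp
  next
    case False
    then show ?thesis
      using successively_nth[OF adj(1), of i] that nxt[OF that] by (simp add: n_def)
  qed
  have e: "e i \<in> parcs Q" "{fst (e i), snd (e i)} = {vs ! i, vs ! nxt i}" if "i < n" for i
    using adj'[OF that] by (auto simp: e_def adjacent_def)
  have "inj_on e {..<n}"
  proof (rule inj_onI)
    fix i j assume ij: "i \<in> {..<n}" "j \<in> {..<n}" "e i = e j"
    then have "{vs ! i, vs ! nxt i} = {vs ! j, vs ! nxt j}"
      using e(2) by (metis lessThan_iff)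
    moreover have "nxt i < n" "nxt j < n" using n by (auto simp: nxt_def)
    \<comment> \<open>Positions with the same end points are equal or cyclic successors of each
      other; the latter would force \<open>n \<le> 2\<close>.\<close>
    ultimately have "i = j \<or> i = nxt j \<and> nxt i = j"
      using ij vs(1) by (auto simp: doubleton_eq_iff nth_eq_iff_index_eq n_def)
    then show "i = j" using nxt ij n by (auto split: if_splits)
  qed
  then have "distinct (map e [0..<n])" by (simp add: distinct_map atLeast0LessThan)
  moreover have "set vs \<subseteq> pverts Q"
    using adjacent_in_pverts(1)[OF tree adj'] by (auto simp: in_set_conv_nth n_def)
  ultimately have "underlying_cycle Q vs (map e [0..<n])"
    using e vs n unfolding underlying_cycle_def by (auto simp: n_def nxt_def)
  then show False using tree by (auto simp: tree_quiver_def)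
qed

lemma successively_upt:
  assumes "\<And>k. i \<le> k \<Longrightarrow> Suc k < j \<Longrightarrow> P k (Suc k)"
  shows "successively P [i..<j]"
  using assms by (auto simp: successively_conv_nth)

section \<open>How journeys meet a ray\<close>

context
  fixes Q :: "'v pair_pre_digraph" and f :: "nat \<Rightarrow> 'v"
  assumes tree: "tree_quiver Q" and inj: "inj f"
    and ray: "\<And>i. adjacent Q (f i) (f (Suc i))"
begin

text \<open>A chord closes the segment of the ray between its ends to a cycle, and equal ends would
  give a loop.\<close>

lemma ray_no_chord:
  assumes "adjacent Q (f i) (f k)"
  shows "k = Suc i \<or> i = Suc k"
proof -
  have *: False if "adjacent Q (f i) (f k)" "Suc i < k" for i k
  proof (rule tree_quiver_no_cycle[OF tree, of "map f [i..<Suc k]"])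
    show "distinct (map f [i..<Suc k])"
      using inj by (simp add: distinct_map inj_on_subset)
    show "successively (adjacent Q) (map f [i..<Suc k])"
      using ray by (simp add: successively_map successively_upt del: upt_Suc)
    show "adjacent Q (last (map f [i..<Suc k])) (hd (map f [i..<Suc k]))"
      using adjacent_sym[OF that(1)] that(2) by (simp add: last_map hd_map del: upt_Suc)
  qed (use that in auto)
  have "i \<noteq> k" using assms tree_quiver_antisym[OF tree] by (auto simp: adjacent_def)
  then show ?thesis using *[OF assms] *[OF adjacent_sym[OF assms]] by fastforce
qed

text \<open>The path \<open>g\<close> leaves the ray at \<open>f i\<close> and returns at
  \<open>f k\<close> without touching it in between, so together with the segment of the ray between
  these vertices it forms a cycle.\<close>

lemma ray_no_ear:
  assumes g: "inj_on g {p..q}" "\<And>r. p \<le> r \<Longrightarrow> r < q \<Longrightarrow> adjacent Q (g r) (g (Suc r))"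
    and pq: "Suc p < q" "g p = f i" "g q = f k"
    and avoid: "\<And>r. p < r \<Longrightarrow> r < q \<Longrightarrow> g r \<notin> range f"
  shows False
proof -
  \<comment> \<open>\<open>bk\<close> lists the positions on the ray from \<open>k\<close> back
    towards \<open>i\<close>, without \<open>i\<close> itself, since \<open>f i = g p\<close> is
    already contributed by \<open>g\<close>.\<close>
  define bk where "bk = (if i < k then rev [Suc i..<Suc k] else [k..<i])"
  have "g p \<noteq> g q" using g(1) pq(1) by (auto dest: inj_onD)
  then have "i \<noteq> k" using pq by auto
  then have bk: "bk \<noteq> []" "hd bk = k" "i \<notin> set bk" "distinct bk"
    by (auto simp: bk_def hd_rev simp del: upt_Suc)
  have ray': "adjacent Q (f (Suc j)) (f j)" for j using ray adjacent_sym by fast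
  have bk': "successively (adjacent Q) (map f bk)"
    using ray ray' by (auto simp: bk_def successively_map successively_upt simp del: upt_Suc)
  have last: "adjacent Q (f (last bk)) (f i)"
    using ray' ray[of "i - 1"] \<open>i \<noteq> k\<close> by (auto simp: bk_def last_rev simp del: upt_Suc)
  \<comment> \<open>The part of \<open>g\<close> stops before \<open>q\<close>, because
    \<open>g q = f k\<close> opens the second part. By \<open>Suc p < q\<close> it has at least two
    vertices, so the cycle has at least three.\<close>
  show False
  proof (rule tree_quiver_no_cycle[OF tree, of "map g [p..<q] @ map f bk"])
    have "distinct (map g [p..<q])"
      using g(1) by (auto simp: distinct_map intro: inj_on_subset)
    moreover have "distinct (map f bk)"
      using bk(4) inj_on_subset[OF inj] by (simp add: distinct_map)
    moreover have "g ` {p..<q} \<inter> f ` set bk = {}"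
    proof -
      have "g r \<notin> f ` set bk" if "r \<in> {p..<q}" for r
        using that avoid[of r] pq(2) bk(3) inj by (cases "r = p") (auto dest: injD)
      then show ?thesis by blast
    qed
    ultimately show "distinct (map g [p..<q] @ map f bk)" by (simp only: distinct_append set_map set_upt)
    have "successively (adjacent Q) (map g [p..<q])"
      using g(2) by (simp add: successively_map successively_upt)
    moreover have "adjacent Q (g (last [p..<q])) (g q)"
      using g(2)[of "q - 1"] pq(1) by (simp add: last_upt)
    ultimately show "successively (adjacent Q) (map g [p..<q] @ map f bk)"
      using bk bk' pq by (auto simp: successively_append_iff last_map hd_map)
    show "adjacent Q (last (map g [p..<q] @ map f bk)) (hd (map g [p..<q] @ map f bk))"
      using bk last pq by (auto simp: last_map hd_map)
    show "3 \<le> length (map g [p..<q] @ map f bk)"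
      using pq(1) bk(1) by (cases bk) auto
  qed
qed

text \<open>Were \<open>g r\<close> off the ray, the last visit to the ray before \<open>r\<close>
  and the first one after \<open>r\<close> would bound an ear.\<close>

lemma ray_convex:
  assumes g: "inj_on g {p..q}" "\<And>r. p \<le> r \<Longrightarrow> r < q \<Longrightarrow> adjacent Q (g r) (g (Suc r))"
    and pq: "g p \<in> range f" "g q \<in> range f" and r: "p \<le> r" "r \<le> q"
  shows "g r \<in> range f"
proof (rule ccontr)
  assume notin: "g r \<notin> range f"
  define q' where "q' = (LEAST s. r \<le> s \<and> g s \<in> range f)"
  have q': "r \<le> q'" "g q' \<in> range f" "q' \<le> q"
    using LeastI[of "\<lambda>s. r \<le> s \<and> g s \<in> range f" q] Least_le[of "\<lambda>s. r \<le> s \<and> g s \<in> range f" q] r pq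
    by (auto simp: q'_def)
  have above: "g s \<notin> range f" if "r \<le> s" "s < q'" for s
    using not_less_Least that unfolding q'_def by blast
  define p' where "p' = (GREATEST s. s \<le> r \<and> g s \<in> range f)"
  have p': "p' \<le> r" "g p' \<in> range f" "p \<le> p'"
    using GreatestI_nat[of "\<lambda>s. s \<le> r \<and> g s \<in> range f" p r]
      Greatest_le_nat[of "\<lambda>s. s \<le> r \<and> g s \<in> range f" p r] r pq
    by (auto simp: p'_def)
  have below: "g s \<notin> range f" if "s \<le> r" "p' < s" for s
    using Greatest_le_nat[of "\<lambda>s. s \<le> r \<and> g s \<in> range f" s r] that by (auto simp: p'_def)
  have "p' < r" "r < q'" using p' q' notin by (metis le_neq_implies_less)+
  obtain i k where ik: "g p' = f i" "g q' = f k" using p' q' by blast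
  have "inj_on g {p'..q'}" using g(1) by (rule inj_on_subset) (use p' q' in auto)
  moreover have "adjacent Q (g s) (g (Suc s))" if "p' \<le> s" "s < q'" for s
    using g(2)[of s] that p'(3) q'(3) by simp
  moreover have "Suc p' < q'" using \<open>p' < r\<close> \<open>r < q'\<close> by simp
  moreover have "g s \<notin> range f" if "p' < s" "s < q'" for s
    using above[of s] below[of s] that by linarith
  ultimately show False using ray_no_ear[of g p' q' i k] ik by blast
qed

text \<open>By convexity the visits of \<open>g\<close> to the ray form an interval of positions, so
  there is at most one exit and at most one entry.\<close>

lemma finite_journey_exits:
  assumes "journey Q P g"
  shows "finite {(i, j) \<in> parcs P. (g i \<in> range f) \<noteq> (g j \<in> range f)}"
proof -
  have path: "path_quiver P" and hom: "quiver_morphism P Q g" and injg: "inj_on g (pverts P)"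
    using assms by (auto simp: journey_def)
  have down: "i \<in> pverts P" if "j \<in> pverts P" "i \<le> j" for i j
    using path that by (auto simp: path_quiver_def)
  have adj: "adjacent Q (g i) (g (Suc i))" if "Suc i \<in> pverts P" for i
    using path hom that by (fastforce simp: path_quiver_def quiver_morphism_def adjacent_def)
  have convex: "g r \<in> range f"
    if "q \<in> pverts P" "g p \<in> range f" "g q \<in> range f" "p \<le> r" "r \<le> q" for p q r
  proof (rule ray_convex[of g p q])
    show "inj_on g {p..q}" using injg down[OF that(1)] by (auto intro: inj_on_subset)
    show "adjacent Q (g s) (g (Suc s))" if "s < q" for s
      using adj down[OF \<open>q \<in> pverts P\<close>] that by auto
  qed (use that in auto)
  have finite_unique: "finite D" if "\<And>r s. r \<in> D \<Longrightarrow> s \<in> D \<Longrightarrow> \<not> r < s" for D :: "nat set"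
  proof (cases "D = {}")
    case False
    then obtain r where "r \<in> D" by blast
    then have "D \<subseteq> {r}" using that by (metis linorder_neqE_nat singletonI subsetI)
    then show ?thesis using finite_subset by blast
  qed simp
  \<comment> \<open>\<open>D1\<close> collects the exits and \<open>D2\<close> the entries in the
    order of increasing positions, whatever the direction of the arrow; each is indexed by the
    smaller position of its edge.\<close>
  define D1 where "D1 = {r. Suc r \<in> pverts P \<and> g r \<in> range f \<and> g (Suc r) \<notin> range f}"
  define D2 where "D2 = {r. Suc r \<in> pverts P \<and> g r \<notin> range f \<and> g (Suc r) \<in> range f}"
  have "finite D1"
  proof (rule finite_unique)
    fix r s assume rs: "r \<in> D1" "s \<in> D1"
    then show "\<not> r < s"
      using convex[of s r "Suc r"] down[of "Suc s" s] by (auto simp: D1_def)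
  qed
  moreover have "finite D2"
  proof (rule finite_unique)
    fix r s assume rs: "r \<in> D2" "s \<in> D2"
    then show "\<not> r < s"
      using convex[of "Suc s" "Suc r" s] by (auto simp: D2_def)
  qed
  moreover have "{(i, j) \<in> parcs P. (g i \<in> range f) \<noteq> (g j \<in> range f)} \<subseteq>
      (\<lambda>r. (r, Suc r)) ` (D1 \<union> D2) \<union> (\<lambda>r. (Suc r, r)) ` (D1 \<union> D2)"
  proof (rule subrelI)
    fix i j assume ij: "(i, j) \<in> {(i, j) \<in> parcs P. (g i \<in> range f) \<noteq> (g j \<in> range f)}"
    then have "i \<in> pverts P" "j \<in> pverts P"
      using path pair_wf_digraph.in_arcsD1 pair_wf_digraph.in_arcsD2
      unfolding path_quiver_def by fast+
    moreover have "j = Suc i \<or> i = Suc j" using path ij by (auto simp: path_quiver_def)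
    ultimately show "(i, j) \<in> (\<lambda>r. (r, Suc r)) ` (D1 \<union> D2) \<union> (\<lambda>r. (Suc r, r)) ` (D1 \<union> D2)"
      using ij by (auto simp: D1_def D2_def)
  qed
  ultimately show ?thesis by (meson finite_UnI finite_imageI finite_subset)
qed

text \<open>All arrows lie on finitely many journeys, and each journey has finitely many arrows with
  exactly one end on the ray. Beyond the last such end every neighbour is on the ray, and the ray
  has no chords.\<close>

lemma ray_eventually_pendant:
  assumes "finitely_branching Q"
  obtains N where "\<forall>i y. N < i \<longrightarrow> adjacent Q (f i) y \<longrightarrow> y = f (i - 1) \<or> y = f (Suc i)"
proof -
  obtain J where J: "finite J" "\<forall>(P, g) \<in> J. journey Q P g"
      and arcs: "parcs Q = (\<Union>(P, g) \<in> J. map_prod g g ` parcs P)"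
    using assms unfolding finitely_branching_def by (elim exE conjE)
  define X where "X = {(x, y) \<in> parcs Q. (x \<in> range f) \<noteq> (y \<in> range f)}"
  have "X \<subseteq> (\<Union>(P, g) \<in> J. map_prod g g ` {(i, j) \<in> parcs P. (g i \<in> range f) \<noteq> (g j \<in> range f)})"
  proof (rule subrelI)
    fix x y assume xy: "(x, y) \<in> X"
    then obtain P g i j where "(P, g) \<in> J" "(i, j) \<in> parcs P" "x = g i" "y = g j"
      unfolding X_def arcs by auto
    then show "(x, y) \<in> (\<Union>(P, g) \<in> J.
        map_prod g g ` {(i, j) \<in> parcs P. (g i \<in> range f) \<noteq> (g j \<in> range f)})"
      using xy unfolding X_def by (intro UN_I[of "(P, g)"]) auto
  qed
  moreover have "finite (\<Union>(P, g) \<in> J.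
      map_prod g g ` {(i, j) \<in> parcs P. (g i \<in> range f) \<noteq> (g j \<in> range f)})"
    using J finite_journey_exits by (intro finite_UN_I) auto
  ultimately have "finite X" by (rule finite_subset)
  then have "finite (f -` (fst ` X \<union> snd ` X))" using inj by (intro finite_vimageI) auto
  then obtain N where N: "\<forall>i\<in>f -` (fst ` X \<union> snd ` X). i \<le> N"
    unfolding finite_nat_set_iff_bounded_le ..
  show thesis
  proof (rule that, intro allI impI)
    fix i y assume i: "N < i" and adj: "adjacent Q (f i) y"
    have "y \<in> range f"
    proof (rule ccontr)
      assume "y \<notin> range f"
      then have "(f i, y) \<in> X \<or> (y, f i) \<in> X" using adj by (auto simp: X_def adjacent_def)
      then have "i \<in> f -` (fst ` X \<union> snd ` X)"
        by (auto intro: rev_image_eqI)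
      then have "i \<le> N" using N by (rule bspec[rotated])
      then show False using i by simp
    qed
    then show "y = f (i - 1) \<or> y = f (Suc i)" using ray_no_chord adj by fastforce
  qed
qed

end

text \<open>By the pigeonhole principle one of the finitely many journeys carries infinitely many
  arrows of \<open>A\<close>. It cannot be a finite path, so it is the required ray.\<close>

lemma infinite_arcs_along_ray:
  assumes "finitely_branching Q" "A \<subseteq> parcs Q" "infinite A"
  obtains f :: "nat \<Rightarrow> 'v" where "inj f" "\<forall>i. adjacent Q (f i) (f (Suc i))"
    "infinite {i. (f i, f (Suc i)) \<in> A \<or> (f (Suc i), f i) \<in> A}"
proof -
  obtain J where J: "finite J" "\<forall>(P, g) \<in> J. journey Q P g"
      and arcs: "parcs Q = (\<Union>(P, g) \<in> J. map_prod g g ` parcs P)"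
    using assms(1) unfolding finitely_branching_def by (elim exE conjE)
  have cover: "A \<subseteq> (\<Union>(P, g) \<in> J. map_prod g g ` {(i, j) \<in> parcs P. (g i, g j) \<in> A})"
  proof (rule subrelI)
    fix x y assume xy: "(x, y) \<in> A"
    then have "(x, y) \<in> parcs Q" using assms(2) by blast
    then obtain P g i j where "(P, g) \<in> J" "(i, j) \<in> parcs P" "x = g i" "y = g j"
      unfolding arcs by auto
    then show "(x, y) \<in> (\<Union>(P, g) \<in> J. map_prod g g ` {(i, j) \<in> parcs P. (g i, g j) \<in> A})"
      using xy by (intro UN_I[of "(P, g)"]) auto
  qed
  have "\<exists>P g. (P, g) \<in> J \<and> infinite {(i, j) \<in> parcs P. (g i, g j) \<in> A}"
  proof (rule ccontr)
    assume no: "\<not> ?thesis"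
    have "finite {(i, j) \<in> parcs P. (g i, g j) \<in> A}" if "(P, g) \<in> J" for P g
      using no that by blast
    then have "finite (\<Union>(P, g) \<in> J. map_prod g g ` {(i, j) \<in> parcs P. (g i, g j) \<in> A})"
      using J(1) by (intro finite_UN_I) auto
    with cover have "finite A" by (rule finite_subset)
    with assms(3) show False by simp
  qed
  then obtain P g where Pg: "(P, g) \<in> J" "infinite {(i, j) \<in> parcs P. (g i, g j) \<in> A}"
    by (elim exE conjE)
  let ?I = "{i. (g i, g (Suc i)) \<in> A \<or> (g (Suc i), g i) \<in> A}"
  have path: "path_quiver P" and hom: "quiver_morphism P Q g" and injg: "inj_on g (pverts P)"
    using bspec[OF J(2) Pg(1)] by (auto simp: journey_def)
  have sub: "parcs P \<subseteq> pverts P \<times> pverts P"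
    using path pair_wf_digraph.in_arcsD1 pair_wf_digraph.in_arcsD2
    unfolding path_quiver_def by fast
  have "finite {(i, j) \<in> parcs P. (g i, g j) \<in> A}" if "finite (pverts P)"
    by (rule finite_subset[OF _ finite_cartesian_product[OF that that]]) (use sub in blast)
  then have "infinite (pverts P)" using Pg(2) by blast
  then have UNIV: "pverts P = UNIV" using path by (auto simp: path_quiver_def)
  \<comment> \<open>Each arrow joins consecutive positions in one of two directions, so infinitely
    many arrows occupy infinitely many positions.\<close>
  have "{(i, j) \<in> parcs P. (g i, g j) \<in> A} \<subseteq> (\<lambda>i. (i, Suc i)) ` ?I \<union> (\<lambda>i. (Suc i, i)) ` ?I"
    using path by (fastforce simp: path_quiver_def)
  then have "infinite ?I" using Pg(2) by (meson finite_UnI finite_imageI finite_subset)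
  moreover have "adjacent Q (g i) (g (Suc i))" for i
    using path hom UNIV by (fastforce simp: path_quiver_def quiver_morphism_def adjacent_def)
  ultimately show thesis using that[of g] injg UNIV by simp
qed

section \<open>Locally finite-dimensional indecomposable representations\<close>

text \<open>The tail starts at \<open>f m\<close>, and only there may it be attached to the rest of
  the quiver. Its summand \<open>R\<close>, extended by zero, and its summand \<open>P\<close>,
  extended by the full spaces, give complementary subrepresentations. The vertex \<open>x\<close>,
  which may be \<open>f m\<close> itself, makes the second one nonzero, so the first one vanishes
  and the dimensions along the tail are monotone.\<close>

lemma (in vector_space) ray_eventually_bij:
  fixes V :: "('v, 'b) quiver_rep"
  assumes tree: "tree_quiver Q"
    and rep: "quiver_representation scale Q V"
    and lfd: "locally_finite_dimensional scale Q V"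
    and indec: "indecomposable scale Q V"
    and inj: "inj f" and ray: "\<And>i. adjacent Q (f i) (f (Suc i))"
    and pendant: "\<And>i y. m < i \<Longrightarrow> adjacent Q (f i) y \<Longrightarrow> y = f (i - 1) \<or> y = f (Suc i)"
    and x: "x \<in> pverts Q" "rspace V x \<noteq> {0}" "\<And>i. m < i \<Longrightarrow> x \<noteq> f i"
  obtains M where
    "\<forall>i\<ge>M. (f i, f (Suc i)) \<in> parcs Q \<longrightarrow>
      bij_betw (rmap V (f i, f (Suc i))) (rspace V (f i)) (rspace V (f (Suc i)))"
    "\<forall>i\<ge>M. (f (Suc i), f i) \<in> parcs Q \<longrightarrow>
      bij_betw (rmap V (f (Suc i), f i)) (rspace V (f (Suc i))) (rspace V (f i))"
proof -
  have V: "subspace (rspace V z)" if "z \<in> pverts Q" for z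
    using rep that by (auto simp: quiver_representation_def)
  have lin: "linear_between scale (rspace V z) (rspace V w) (rmap V (z, w))" if "(z, w) \<in> parcs Q" for z w
    using rep that by (auto simp: quiver_representation_def)
  have verts: "z \<in> pverts Q" "w \<in> pverts Q" if "(z, w) \<in> parcs Q" for z w
    using adjacent_in_pverts[OF tree, of z w] that by (auto simp: adjacent_def)
  have zero: "rmap V (z, w) 0 = 0" if "(z, w) \<in> parcs Q" for z w
    using linear_between_zero[OF lin[OF that] V] verts[OF that] by simp
  have fv: "f i \<in> pverts Q" for i using adjacent_in_pverts[OF tree ray] by blast
  \<comment> \<open>Position \<open>n\<close> of the ray to be split is the vertex
    \<open>f (m + n)\<close>, and \<open>ahead\<close> takes the place of
    \<open>out\<close>.\<close>
  define ahead where "ahead n \<longleftrightarrow> (f (m + n), f (Suc (m + n))) \<in> parcs Q" for n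
  define U where "U n = rspace V (f (m + n))" for n
  define F where "F n = rmap V (if ahead n then (f (m + n), f (Suc (m + n)))
      else (f (Suc (m + n)), f (m + n)))" for n
  have arc: "\<not> ahead n \<longleftrightarrow> (f (Suc (m + n)), f (m + n)) \<in> parcs Q" for n
    using ray[of "m + n"] tree_quiver_antisym[OF tree] by (auto simp: ahead_def adjacent_def)
  have U: "subspace (U n)" for n using V fv by (simp add: U_def)
  have fd: "\<exists>B. finite B \<and> U n \<subseteq> span B" for n
    using lfd fv unfolding locally_finite_dimensional_def U_def by (metis order_refl)
  have F_out: "linear_between scale (U n) (U (Suc n)) (F n)" if "ahead n" for n
    using lin[of "f (m + n)" "f (Suc (m + n))"] that by (simp add: U_def F_def ahead_def)
  have F_in: "linear_between scale (U (Suc n)) (U n) (F n)" if "\<not> ahead n" for n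
    using lin[of "f (Suc (m + n))" "f (m + n)"] that arc[of n] by (simp add: U_def F_def)
  obtain P R where split: "\<forall>n. complementary (U n) (P n) (R n)" and R0: "R 0 = {0}"
    and fwd: "\<forall>n. ahead n \<longrightarrow> F n ` P n = P (Suc n) \<and> F n ` R n \<subseteq> R (Suc n)"
    and bwd: "\<forall>n. \<not> ahead n \<longrightarrow>
      F n ` P (Suc n) \<subseteq> P n \<and> inj_on (F n) (P (Suc n)) \<and> F n ` R (Suc n) \<subseteq> R n"
    using ray_splitting[of U ahead F] U fd F_out F_in by metis
  have compl: "complementary (U n) (P n) (R n)" for n using split by blast
  have P0: "P 0 = U 0" using compl[of 0] R0 by (auto simp: complementary_def)
  define W1 where "W1 z = (if z \<in> f ` {m..} then R (inv f z - m) else {0})" for z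
  define W2 where "W2 z = (if z \<in> f ` {m..} then P (inv f z - m) else rspace V z)" for z
  have W_ray: "W1 (f (m + n)) = R n" "W2 (f (m + n)) = P n" for n
    using inj by (auto simp: W1_def W2_def)
  have W_off: "W1 z = {0}" "W2 z = rspace V z" if "z \<notin> f ` {m..}" for z
    using that by (auto simp: W1_def W2_def)
  \<comment> \<open>Since \<open>R 0 = {0}\<close> and \<open>P 0 = U 0\<close>, the description off
    the tail also holds at its first vertex \<open>f m\<close>.\<close>
  have W_end: "W1 z = {0}" "W2 z = rspace V z" if "z \<notin> f ` {m<..}" for z
  proof -
    have "{m..} = insert m {m<..}" by auto
    then have "z = f (m + 0) \<or> z \<notin> f ` {m..}" using that by auto
    then show "W1 z = {0}" "W2 z = rspace V z"
      using W_ray[of 0] W_off R0 P0 by (auto simp: U_def)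
  qed
  have vertex: "(\<exists>n. z = f (m + n)) \<or> z \<notin> f ` {m..}" for z
    by (metis atLeast_iff image_iff le_add_diff_inverse)
  have dir: "direct_sum_of Q V W1 W2" and
    sub: "\<And>z. z \<in> pverts Q \<Longrightarrow> subspace (W1 z) \<and> W1 z \<subseteq> rspace V z \<and> subspace (W2 z) \<and> W2 z \<subseteq> rspace V z"
  proof -
    have *: "complementary (rspace V z) (W2 z) (W1 z)" if "z \<in> pverts Q" for z
      using vertex[of z]
    proof
      assume "\<exists>n. z = f (m + n)"
      then show ?thesis using compl W_ray by (auto simp: U_def)
    next
      assume "z \<notin> f ` {m..}"
      then show ?thesis
        using W_off V[OF that] by (auto simp: complementary_def subspace_0)
    qed
    show "subspace (W1 z) \<and> W1 z \<subseteq> rspace V z \<and> subspace (W2 z) \<and> W2 z \<subseteq> rspace V z"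
      if "z \<in> pverts Q" for z
      using *[OF that] by (simp add: complementary_def)
    have "rspace V z = {u + w |u w. u \<in> W1 z \<and> w \<in> W2 z}" "W1 z \<inter> W2 z = {0}"
      if z: "z \<in> pverts Q" for z
    proof -
      have c: "W2 z \<subseteq> rspace V z" "W1 z \<subseteq> rspace V z" "W2 z \<inter> W1 z = {0}"
        "\<And>u. u \<in> rspace V z \<Longrightarrow> \<exists>p\<in>W2 z. \<exists>r\<in>W1 z. u = p + r"
        using *[OF z] by (auto simp: complementary_def)
      show "W1 z \<inter> W2 z = {0}" using c(3) by blast
      show "rspace V z = {u + w |u w. u \<in> W1 z \<and> w \<in> W2 z}"
      proof
        show "rspace V z \<subseteq> {u + w |u w. u \<in> W1 z \<and> w \<in> W2 z}"
          using c(4) add.commute by blast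
        show "{u + w |u w. u \<in> W1 z \<and> w \<in> W2 z} \<subseteq> rspace V z"
          using c(1,2) V[OF z] subspace_add by blast
      qed
    qed
    then show "direct_sum_of Q V W1 W2" by (simp add: direct_sum_of_def)
  qed
  \<comment> \<open>An arrow with both ends on the tail joins consecutive vertices and is handled by
    the splitting. Any other arrow has no end beyond \<open>f m\<close>, because the vertices there
    only have neighbours on the tail.\<close>
  have arcs: "rmap V (z, w) ` W1 z \<subseteq> W1 w \<and> rmap V (z, w) ` W2 z \<subseteq> W2 w"
    if zw: "(z, w) \<in> parcs Q" for z w
  proof (cases "(\<exists>i\<ge>m. z = f i) \<and> (\<exists>j\<ge>m. w = f j)")
    case True
    then obtain i j where ij: "m \<le> i" "z = f i" "m \<le> j" "w = f j" by blast
    then have "j = Suc i \<or> i = Suc j"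
      using ray_no_chord[OF tree inj ray, of i j] zw by (simp add: adjacent_def)
    then show ?thesis
    proof
      assume j: "j = Suc i"
      define n where "n = i - m"
      have "z = f (m + n)" "w = f (m + Suc n)" using ij j by (simp_all add: n_def)
      then show ?thesis
        using spec[OF fwd, of n] zw W_ray[of n] W_ray[of "Suc n"] by (simp add: ahead_def F_def)
    next
      assume i: "i = Suc j"
      define n where "n = j - m"
      have "w = f (m + n)" "z = f (m + Suc n)" using ij i by (simp_all add: n_def)
      then show ?thesis
        using spec[OF bwd, of n] arc[of n] zw W_ray[of n] W_ray[of "Suc n"] by (simp add: F_def)
    qed
  next
    case False
    have "z \<notin> f ` {m<..} \<and> w \<notin> f ` {m<..}"
    proof (rule ccontr)
      assume "\<not> ?thesis"
      then obtain i y where i: "m < i" "adjacent Q (f i) y" "z = f i \<and> w = y \<or> w = f i \<and> z = y"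
        using zw by (auto simp: adjacent_def)
      then have "y = f (i - 1) \<or> y = f (Suc i)" using pendant by blast
      moreover have "m \<le> i" "m \<le> i - 1" "m \<le> Suc i" using i(1) by auto
      ultimately show False using False i(3) by blast
    qed
    then have "W1 z = {0}" "W1 w = {0}" "W2 z = rspace V z" "W2 w = rspace V w"
      using W_end by auto
    then show ?thesis
      using zero[OF zw] lin[OF zw] by (auto simp: linear_between_def)
  qed
  have "subrepresentation scale Q V W1" "subrepresentation scale Q V W2"
    unfolding subrepresentation_def using sub arcs by blast+
  moreover have "nonzero_family Q W2"
  proof -
    have "x \<notin> f ` {m<..}" using x(3) by auto
    then show ?thesis using x(1,2) W_end(2) unfolding nonzero_family_def by metis
  qed
  ultimately have "\<not> nonzero_family Q W1"
    using indec dir unfolding indecomposable_def by blast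
  then have "R n = {0}" for n using W_ray(1)[of n] fv unfolding nonzero_family_def by metis
  then have PU: "P n = U n" for n
    using compl[of n] unfolding complementary_def by auto
  have surj: "F n ` U n = U (Suc n)" if "ahead n" for n
    using spec[OF fwd, of n] PU that by simp
  have inj': "inj_on (F n) (U (Suc n))" if "\<not> ahead n" for n
    using spec[OF bwd, of n] PU that by simp
  obtain M where M: "\<forall>n\<ge>M. ahead n \<longrightarrow> bij_betw (F n) (U n) (U (Suc n))"
    "\<forall>n\<ge>M. \<not> ahead n \<longrightarrow> bij_betw (F n) (U (Suc n)) (U n)"
    using eventually_bij_of_monotone[of U ahead F] U fd F_out F_in surj inj' by metis
  have "((f i, f (Suc i)) \<in> parcs Q \<longrightarrow>
        bij_betw (rmap V (f i, f (Suc i))) (rspace V (f i)) (rspace V (f (Suc i)))) \<and>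
      ((f (Suc i), f i) \<in> parcs Q \<longrightarrow>
        bij_betw (rmap V (f (Suc i), f i)) (rspace V (f (Suc i))) (rspace V (f i)))"
    if "m + M \<le> i" for i
  proof -
    define n where "n = i - m"
    have n: "i = m + n" "M \<le> n" using that by (simp_all add: n_def)
    show ?thesis
      using M n(2) arc[of n] unfolding n(1) by (simp add: ahead_def U_def F_def)
  qed
  then show thesis by (intro that[of "m + M"]) auto
qed

theorem theorem2:
  fixes scale :: "'k::field \<Rightarrow> 'w::ab_group_add \<Rightarrow> 'w"
    and Q :: "'v pair_pre_digraph"
    and V :: "('v, 'w) quiver_rep"
  assumes "vector_space scale"
    and "tree_quiver Q"
    and "finitely_branching Q"
    and "quiver_representation scale Q V"
    and "locally_finite_dimensional scale Q V"
    and "indecomposable scale Q V"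
  shows "flei Q V"
proof (rule ccontr)
  define A where "A = {(x, y) \<in> parcs Q. \<not> bij_betw (rmap V (x, y)) (rspace V x) (rspace V y)}"
  assume "\<not> flei Q V"
  then have "infinite A" by (simp add: flei_def A_def)
  moreover have "A \<subseteq> parcs Q" by (auto simp: A_def)
  ultimately obtain f where inj: "inj f" and adj: "\<forall>i. adjacent Q (f i) (f (Suc i))"
    and inf: "infinite {i. (f i, f (Suc i)) \<in> A \<or> (f (Suc i), f i) \<in> A}"
    using infinite_arcs_along_ray[OF assms(3)] by blast
  have ray: "adjacent Q (f i) (f (Suc i))" for i using adj by blast
  obtain N where N: "\<forall>i y. N < i \<longrightarrow> adjacent Q (f i) y \<longrightarrow> y = f (i - 1) \<or> y = f (Suc i)"
    using ray_eventually_pendant[OF assms(2) inj ray assms(3)] by blast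
  obtain x where x: "x \<in> pverts Q" "rspace V x \<noteq> {0}"
    using assms(6) by (auto simp: indecomposable_def nonzero_family_def)
  \<comment> \<open>By injectivity \<open>x\<close> occurs at most once on the ray; its position, if
    there is one, serves as \<open>k\<close>.\<close>
  obtain k where k: "\<forall>i. k < i \<longrightarrow> x \<noteq> f i"
    using inj by (metis injD less_irrefl)
  \<comment> \<open>A tail starting at \<open>max N k\<close> is pendant, and \<open>x\<close> is
    either off this tail or its first vertex.\<close>
  have "y = f (i - 1) \<or> y = f (Suc i)" if "max N k < i" "adjacent Q (f i) y" for i y
    using N that by simp
  moreover have "x \<noteq> f i" if "max N k < i" for i
    using k that by simp
  ultimately obtain M where
    "\<forall>i\<ge>M. (f i, f (Suc i)) \<in> parcs Q \<longrightarrow>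
      bij_betw (rmap V (f i, f (Suc i))) (rspace V (f i)) (rspace V (f (Suc i)))"
    "\<forall>i\<ge>M. (f (Suc i), f i) \<in> parcs Q \<longrightarrow>
      bij_betw (rmap V (f (Suc i), f i)) (rspace V (f (Suc i))) (rspace V (f i))"
    using vector_space.ray_eventually_bij[OF assms(1,2,4,5,6) inj ray _ x, of "max N k"] by blast
  \<comment> \<open>All edges of the ray in \<open>A\<close> have positions below \<open>M\<close>,
    whereas the ray was chosen with infinitely many of them.\<close>
  then have "{i. (f i, f (Suc i)) \<in> A \<or> (f (Suc i), f i) \<in> A} \<subseteq> {..<M}"
    by (auto simp: A_def simp flip: not_le)
  then show False using inf finite_subset[OF _ finite_lessThan] by blast
qed

end
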